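(* Let $m,n\ge1$, let $\vec{\mathbf r}=(r_1,\dots,r_m)\in\mathbb R^m$, let $\vec l_1,\dots,\vec l_m\in\mathbb R^n$ be row vectors, and let $p$ be a real polynomial in $n$ variables of degree $\le2$. For a column vector $\vec{\mathbf z}=(z_1,\dots,z_n)^T\in\mathbb C^n$ with $e^{\sqrt{-1}\,\vec l_k\vec{\mathbf z}}\notin[1,\infty)$ for all $k$, put $$f(\vec{\mathbf z})=\sum_{k=1}^m r_k\,\mathrm{Li}_2\big(e^{\sqrt{-1}\,\vec l_k\vec{\mathbf z}}\big)+p(\vec{\mathbf z}).$$ Then $$\mathrm{Im} f(\vec{\mathbf z})=\sum_{k=1}^m r_k\,\mathrm D_2\big(e^{\sqrt{-1}\,\vec l_k\vec{\mathbf z}}\big)+\big(\mathrm{Re}\,\nabla f(\vec{\mathbf z})\big)\,\mathrm{Im}\,\vec{\mathbf z},$$ where $\nabla f=(\partial f/\partial z_1,\dots,\partial f/\partial z_n)$ is the row vector of complex derivatives. In particular, if $\nabla f(\vec{\mathbf z}_0)=\vec 0$, then $$\mathrm{Im} f(\vec{\mathbf z}_0)=\sum_{k=1}^m r_k\,\mathrm D_2\big(e^{\sqrt{-1}\,\vec l_k\vec{\mathbf z}_0}\big).$$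
   Context: $\log$ is the principal logarithm on $\mathbb C\setminus(-\infty,0]$. $\mathrm{Li}_2(z)=-\int_0^z\frac{\log(1-t)}t\,dt$ along any path in $\mathbb C\setminus(1,\infty)$; it is holomorphic on $\mathbb C\setminus[1,\infty)$. The Bloch–Wigner function is $\mathrm D_2(z)=\mathrm{Im}\,\mathrm{Li}_2(z)+\log|z|\cdot\mathrm{Im}\log(1-z)$ for $z\ne0,1$, and $\mathrm D_2(0)=\mathrm D_2(1)=0$. *)

theory Defs
  imports "HOL-Complex_Analysis.Complex_Analysis" "HOL-Library.Poly_Mapping"
begin

subsection \<open>The dilogarithm and the Bloch--Wigner function\<close>

text \<open>The singularity of the integrand at 0 is removable; the value there is the limit.\<close>

definition dilog_integrand :: "complex \<Rightarrow> complex" where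
  "dilog_integrand t = (if t = 0 then 1 else - Ln (1 - t) / t)"

text \<open>The straight segment from 0 to \<open>z\<close> serves as path. It stays in the plane cut along
  the reals greater than 1 whenever \<open>z\<close> lies there, and the lemma \<open>dilog_path_independent\<close>
  shows that every other path gives the same value.\<close>

definition dilog :: "complex \<Rightarrow> complex" where
  "dilog z = contour_integral (linepath 0 z) dilog_integrand"

definition bloch_wigner :: "complex \<Rightarrow> real" where
  "bloch_wigner z =
     (if z = 0 \<or> z = 1 then 0 else Im (dilog z) + ln (cmod z) * Im (Ln (1 - z)))"

abbreviation dilog_cut :: "complex set" where
  "dilog_cut \<equiv> complex_of_real ` {1..}"

lemma mem_dilog_cut_iff: "t \<in> dilog_cut \<longleftrightarrow> 1 - t \<in> \<real>\<^sub>\<le>\<^sub>0"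
proof
  assume "1 - t \<in> \<real>\<^sub>\<le>\<^sub>0"
  then have "t = complex_of_real (Re t)" "1 \<le> Re t"
    by (auto simp: complex_nonpos_Reals_iff complex_eq_iff)
  then show "t \<in> dilog_cut" by (metis atLeast_iff image_eqI)
qed (auto simp: complex_nonpos_Reals_iff)

lemma open_dilog_domain: "open (- dilog_cut)"
proof -
  have "- dilog_cut = (\<lambda>t. 1 - t) -` (- \<real>\<^sub>\<le>\<^sub>0)"
    using mem_dilog_cut_iff by auto
  moreover have "open ((\<lambda>t. 1 - t) -` (- \<real>\<^sub>\<le>\<^sub>0 :: complex set))"
    by (intro open_vimage continuous_intros) (auto simp: open_Compl)
  ultimately show ?thesis by simp
qed

lemma segment_dilog_domain:
  assumes "z \<notin> dilog_cut"
  shows "closed_segment 0 z \<subseteq> - dilog_cut"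
proof
  fix t assume "t \<in> closed_segment 0 z"
  then obtain u :: real where u: "0 \<le> u" "u \<le> 1" "t = u *\<^sub>R z"
    by (auto simp: closed_segment_def)
  show "t \<in> - dilog_cut"
  proof
    assume "t \<in> dilog_cut"
    then obtain x where x: "x \<ge> 1" "u *\<^sub>R z = of_real x" using u by auto
    then have "u > 0" using u by (cases "u = 0") auto
    then have "z = of_real (x / u)" using x by (simp add: scaleR_conv_of_real field_simps)
    moreover have "x / u \<ge> 1" using x u \<open>u > 0\<close> by (simp add: field_simps)
    ultimately show False using assms by (metis atLeast_iff image_eqI)
  qed
qed

lemma starlike_dilog_domain: "starlike (- dilog_cut)"
  unfolding starlike_def using segment_dilog_domain by (intro bexI[of _ 0]) auto

lemma holomorphic_dilog_integrand: "dilog_integrand holomorphic_on (- dilog_cut)"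
proof (rule pole_theorem_open_0[where g = "\<lambda>t. - Ln (1 - t)" and a = 0])
  show "(\<lambda>t. - Ln (1 - t)) holomorphic_on - dilog_cut"
    by (intro holomorphic_intros) (use mem_dilog_cut_iff in blast)
  have "((\<lambda>t. - Ln (1 - t)) has_field_derivative 1) (at 0)"
    by (auto intro!: derivative_eq_intros)
  then show "dilog_integrand 0 = deriv (\<lambda>t. - Ln (1 - t)) 0"
    by (simp add: dilog_integrand_def DERIV_imp_deriv)
qed (auto simp: dilog_integrand_def open_dilog_domain)

lemma dilog_path_independent:
  assumes "valid_path g" "path_image g \<subseteq> - dilog_cut" "pathstart g = 0" "pathfinish g = z"
  shows "(dilog_integrand has_contour_integral dilog z) g"
proof -
  obtain F where F: "\<And>t. t \<in> - dilog_cut \<Longrightarrow> (F has_field_derivative dilog_integrand t) (at t)"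
    using holomorphic_starlike_primitive[OF holomorphic_on_imp_continuous_on
        [OF holomorphic_dilog_integrand] starlike_dilog_domain open_dilog_domain, of "{}"]
      holomorphic_dilog_integrand open_dilog_domain
    by (auto simp: holomorphic_on_open field_differentiable_def)
  have D: "(F has_field_derivative dilog_integrand t) (at t within - dilog_cut)"
    if "t \<in> - dilog_cut" for t
    using F[OF that] has_field_derivative_at_within by blast
  have "(dilog_integrand has_contour_integral (F z - F 0)) g"
    using contour_integral_primitive[OF D, of g] assms by simp
  moreover have "z \<notin> dilog_cut"
    using assms pathfinish_in_path_image by blast
  then have "(dilog_integrand has_contour_integral (F z - F 0)) (linepath 0 z)"
    using contour_integral_primitive[OF D, of "linepath 0 z"] segment_dilog_domain by simp
  ultimately show ?thesis
    by (simp add: dilog_def contour_integral_unique)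
qed

subsection \<open>Real polynomials in the variables \<open>'n\<close>\<close>

text \<open>A polynomial maps each exponent vector to the coefficient of its monomial.\<close>

type_synonym 'n rpoly = "('n \<Rightarrow>\<^sub>0 nat) \<Rightarrow>\<^sub>0 real"

definition rpoly_degree :: "'n::finite rpoly \<Rightarrow> nat" where
  "rpoly_degree p =
     Max (insert 0 ((\<lambda>a. \<Sum>i\<in>UNIV. Poly_Mapping.lookup a i) ` Poly_Mapping.keys p))"

definition rpoly_eval :: "'n::finite rpoly \<Rightarrow> complex ^ 'n \<Rightarrow> complex" where
  "rpoly_eval p z =
     (\<Sum>a\<in>Poly_Mapping.keys p. of_real (Poly_Mapping.lookup p a) *
        (\<Prod>i\<in>UNIV. (z $ i) ^ Poly_Mapping.lookup a i))"

subsection \<open>Exponentials of linear forms and the complex gradient\<close>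

definition exp_form :: "real ^ 'n \<Rightarrow> complex ^ 'n \<Rightarrow> complex" where
  "exp_form v z = exp (\<i> * (\<Sum>j\<in>UNIV. of_real (v $ j) * z $ j))"

text \<open>The \<open>j\<close>-th entry is the derivative of \<open>f\<close> in the \<open>j\<close>-th coordinate, the others being
  held fixed.\<close>

definition complex_gradient :: "(complex ^ 'n \<Rightarrow> complex) \<Rightarrow> complex ^ 'n \<Rightarrow> complex ^ 'n" where
  "complex_gradient f z = (\<chi> j. deriv (\<lambda>w. f (\<chi> i. if i = j then w else z $ i)) (z $ j))"

end

theory Submission
  imports Defs
begin

text \<open>Call a function Euler-like at \<open>z\<close> with defect \<open>h\<close> if its imaginary part is
  \<open>h + Re (gradient) \<bullet> Im z\<close>; this is linear over the reals in the pair (function, defect).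
  A dilogarithm term \<open>Li\<^sub>2 (exp (\<i> l z))\<close> has defect \<open>D\<^sub>2\<close>, because its \<open>j\<close>-th derivative is
  \<open>-\<i> l\<^sub>j log (1 - exp (\<i> l z))\<close> while \<open>log \<bar>exp (\<i> l z)\<bar> = - l \<bullet> Im z\<close>. A real monomial of
  degree at most 2 has defect 0.\<close>

section \<open>Coordinate slices and closure properties of Euler-like functions\<close>

definition coord_update :: "complex ^ 'n \<Rightarrow> 'n \<Rightarrow> complex \<Rightarrow> complex ^ 'n" where
  "coord_update z j w = (\<chi> i. if i = j then w else z $ i)"

lemma coord_update_nth: "coord_update z j w $ i = (if i = j then w else z $ i)"
  by (simp add: coord_update_def)

lemma coord_update_self [simp]: "coord_update z j (z $ j) = z"
  by (simp add: vec_eq_iff coord_update_nth)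

lemma complex_gradient_nth:
  "complex_gradient f z $ j = deriv (\<lambda>w. f (coord_update z j w)) (z $ j)"
  by (simp add: complex_gradient_def coord_update_def)

lemma DERIV_coord_update:
  "((\<lambda>w. coord_update z j w $ i) has_field_derivative (if i = j then 1 else 0)) (at x)"
  by (cases "i = j") (auto simp: coord_update_nth)

lemma continuous_on_coord_update: "continuous_on S (coord_update z j)"
  unfolding coord_update_def
proof (rule continuous_on_vec_lambda)
  show "continuous_on S (\<lambda>w. if i = j then w else z $ i)" for i
    by (cases "i = j") auto
qed

text \<open>The partial derivatives are witnessed by \<open>D\<close> rather than written with
  \<open>deriv\<close>, so that differentiability is carried along and the sum and product rules
  apply.\<close>

definition Im_euler :: "(complex ^ 'n \<Rightarrow> complex) \<Rightarrow> real \<Rightarrow> complex ^ 'n \<Rightarrow> bool" where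
  "Im_euler g h z \<longleftrightarrow>
     (\<exists>D. (\<forall>j. ((\<lambda>w. g (coord_update z j w)) has_field_derivative D j) (at (z $ j))) \<and>
          Im (g z) = h + (\<Sum>j\<in>UNIV. Re (D j) * Im (z $ j)))"

lemma Im_eulerI:
  fixes g :: "complex ^ 'n \<Rightarrow> complex" and z :: "complex ^ 'n"
  assumes "\<And>j. ((\<lambda>w. g (coord_update z j w)) has_field_derivative D j) (at (z $ j))"
    and "Im (g z) = h + (\<Sum>j\<in>UNIV. Re (D j) * Im (z $ j))"
  shows "Im_euler g h z"
  using assms unfolding Im_euler_def by blast

lemma Im_euler_gradient:
  assumes "Im_euler g h z"
  shows "Im (g z) = h + (\<Sum>j\<in>UNIV. Re (complex_gradient g z $ j) * Im (z $ j))"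
  using assms unfolding Im_euler_def complex_gradient_nth
  by (metis (no_types, lifting) DERIV_imp_deriv sum.cong)

text \<open>Serves a function prescribed only on an open set: its partial derivatives at
  \<open>z\<close> depend only on values near \<open>z\<close>.\<close>

lemma Im_euler_transform_open:
  assumes "Im_euler g h z" and "open S" "z \<in> S" and eq: "\<And>x. x \<in> S \<Longrightarrow> f x = g x"
  shows "Im_euler f h z"
proof -
  obtain D where D: "\<And>j. ((\<lambda>w. g (coord_update z j w)) has_field_derivative D j) (at (z $ j))"
    and Im: "Im (g z) = h + (\<Sum>j\<in>UNIV. Re (D j) * Im (z $ j))"
    using assms(1) unfolding Im_euler_def by blast
  have "((\<lambda>w. f (coord_update z j w)) has_field_derivative D j) (at (z $ j))" for j
  proof (rule has_field_derivative_transform_within_open[OF D])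
    \<comment> \<open>This preimage is the neighbourhood of \<open>z $ j\<close> on which the two
      slices agree.\<close>
    show "open (coord_update z j -` S)"
      by (rule open_vimage[OF \<open>open S\<close> continuous_on_coord_update])
  qed (use \<open>z \<in> S\<close> eq in auto)
  then show ?thesis
    by (rule Im_eulerI) (simp add: Im eq[OF \<open>z \<in> S\<close>])
qed

lemma Im_euler_add:
  assumes "Im_euler g h z" "Im_euler g' h' z"
  shows "Im_euler (\<lambda>x. g x + g' x) (h + h') z"
proof -
  obtain D D' where
    D: "\<And>j. ((\<lambda>w. g (coord_update z j w)) has_field_derivative D j) (at (z $ j))"
      "\<And>j. ((\<lambda>w. g' (coord_update z j w)) has_field_derivative D' j) (at (z $ j))"
    and Im: "Im (g z) = h + (\<Sum>j\<in>UNIV. Re (D j) * Im (z $ j))"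
      "Im (g' z) = h' + (\<Sum>j\<in>UNIV. Re (D' j) * Im (z $ j))"
    using assms unfolding Im_euler_def by blast
  show ?thesis
    by (rule Im_eulerI[OF DERIV_add[OF D]]) (simp add: Im distrib_right sum.distrib)
qed

text \<open>A real factor passes through both \<open>Im\<close> and \<open>Re\<close>; this is where
  real coefficients enter.\<close>

lemma Im_euler_cmult:
  assumes "Im_euler g h z"
  shows "Im_euler (\<lambda>x. of_real c * g x) (c * h) z"
proof -
  obtain D where D: "\<And>j. ((\<lambda>w. g (coord_update z j w)) has_field_derivative D j) (at (z $ j))"
    and Im: "Im (g z) = h + (\<Sum>j\<in>UNIV. Re (D j) * Im (z $ j))"
    using assms unfolding Im_euler_def by blast
  show ?thesis
    by (rule Im_eulerI[OF DERIV_cmult[OF D]])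
      (simp add: Im distrib_left sum_distrib_left mult.assoc)
qed

lemma Im_euler_const: "Im c = 0 \<Longrightarrow> Im_euler (\<lambda>x. c) 0 z"
  by (rule Im_eulerI[OF DERIV_const]) simp

lemma Im_euler_sum:
  assumes "\<And>k. k \<in> A \<Longrightarrow> Im_euler (g k) (h k) z"
  shows "Im_euler (\<lambda>x. \<Sum>k\<in>A. g k x) (\<Sum>k\<in>A. h k) z"
  using assms
  by (induction A rule: infinite_finite_induct) (auto intro: Im_euler_const Im_euler_add)

section \<open>Real polynomials of degree at most 2\<close>

lemma Im_euler_coord: "Im_euler (\<lambda>x. x $ i) 0 z"
  by (rule Im_eulerI[OF DERIV_coord_update])
    (simp add: if_distrib[of Re] if_distrib[of "\<lambda>c. c * _"] cong: if_cong)

text \<open>The identity is \<open>Im (a * b) = Re b * Im a + Re a * Im b\<close>. For cubic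
  monomials the analogue fails, hence the bound on the degree.\<close>

lemma Im_euler_coord_mult: "Im_euler (\<lambda>x. x $ i * x $ k) 0 z"
proof (rule Im_eulerI)
  show "((\<lambda>w. coord_update z j w $ i * coord_update z j w $ k) has_field_derivative
      (if i = j then 1 else 0) * z $ k + (if k = j then 1 else 0) * z $ i) (at (z $ j))" for j
    using DERIV_mult[OF DERIV_coord_update[of z j i "z $ j"] DERIV_coord_update[of z j k "z $ j"]]
    by simp
  \<comment> \<open>One Kronecker sum per factor; keeping them apart also covers the square
    \<open>i = k\<close>.\<close>
  have "(\<Sum>j\<in>UNIV. Re ((if i = j then 1 else 0) * z $ k + (if k = j then 1 else 0) * z $ i) * Im (z $ j))
      = (\<Sum>j\<in>UNIV. (if i = j then Re (z $ k) * Im (z $ j) else 0))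
        + (\<Sum>j\<in>UNIV. (if k = j then Re (z $ i) * Im (z $ j) else 0))"
    unfolding sum.distrib[symmetric] by (rule sum.cong) (auto simp: distrib_right)
  then show "Im (z $ i * z $ k) = 0 +
      (\<Sum>j\<in>UNIV. Re ((if i = j then 1 else 0) * z $ k + (if k = j then 1 else 0) * z $ i) * Im (z $ j))"
    by simp
qed

text \<open>Lowering one nonzero exponent by 1 peels off a variable; at most two such steps bring a
  monomial of degree at most 2 to \<open>1\<close>, a coordinate or a product of two
  coordinates.\<close>

lemma monomial_split:
  fixes u :: "'n::finite \<Rightarrow> nat"
  assumes "sum u UNIV = Suc d"
  obtains i v where "sum v UNIV = d"
    "\<And>x :: complex ^ 'n. (\<Prod>i\<in>UNIV. (x $ i) ^ u i) = x $ i * (\<Prod>i\<in>UNIV. (x $ i) ^ v i)"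
proof -
  obtain i where i: "u i \<noteq> 0"
    using assms by (metis Zero_not_Suc sum.neutral)
  define v where "v = u(i := u i - 1)"
  have rest: "sum v (UNIV - {i}) = sum u (UNIV - {i})"
    "(\<Prod>j\<in>UNIV - {i}. (x $ j) ^ v j) = (\<Prod>j\<in>UNIV - {i}. (x $ j) ^ u j)" for x :: "complex ^ 'n"
    by (auto simp: v_def intro!: sum.cong prod.cong)
  have "sum v UNIV = d"
    using assms i sum.remove[of UNIV i u] sum.remove[of UNIV i v] rest(1) by (simp add: v_def)
  moreover have "(\<Prod>j\<in>UNIV. (x $ j) ^ u j) = x $ i * (\<Prod>j\<in>UNIV. (x $ j) ^ v j)"
    for x :: "complex ^ 'n"
  proof -
    have "x $ i * (x $ i) ^ v i = (x $ i) ^ u i"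
      using i by (simp add: v_def flip: power_Suc)
    then show ?thesis
      using prod.remove[of UNIV i "\<lambda>j. (x $ j) ^ u j"] prod.remove[of UNIV i "\<lambda>j. (x $ j) ^ v j"]
        rest(2)[of x] by simp
  qed
  ultimately show ?thesis by (rule that)
qed

lemma Im_euler_monomial:
  fixes u :: "'n::finite \<Rightarrow> nat"
  assumes "sum u UNIV \<le> 2"
  shows "Im_euler (\<lambda>x. \<Prod>i\<in>UNIV. (x $ i) ^ u i) 0 z"
proof -
  consider "sum u UNIV = 0" | "sum u UNIV = Suc 0" | "sum u UNIV = Suc (Suc 0)"
    using assms by linarith
  then show ?thesis
  proof cases
    case 1
    then show ?thesis by (simp add: Im_euler_const)
  next
    case 2
    then obtain i v where v: "sum v UNIV = 0"
      and eq: "\<And>x :: complex ^ 'n. (\<Prod>i\<in>UNIV. (x $ i) ^ u i) = x $ i * (\<Prod>i\<in>UNIV. (x $ i) ^ v i)"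
      by (rule monomial_split) (rule that)
    show ?thesis unfolding eq using v Im_euler_coord by simp
  next
    case 3
    then obtain i v where v: "sum v UNIV = Suc 0"
      and eq: "\<And>x :: complex ^ 'n. (\<Prod>i\<in>UNIV. (x $ i) ^ u i) = x $ i * (\<Prod>i\<in>UNIV. (x $ i) ^ v i)"
      by (rule monomial_split) (rule that)
    from v obtain k v' where v': "sum v' UNIV = 0"
      and eq': "\<And>x :: complex ^ 'n. (\<Prod>i\<in>UNIV. (x $ i) ^ v i) = x $ k * (\<Prod>i\<in>UNIV. (x $ i) ^ v' i)"
      by (rule monomial_split) (rule that)
    show ?thesis unfolding eq eq' using v' Im_euler_coord_mult by simp
  qed
qed

lemma sum_lookup_le_rpoly_degree:
  "a \<in> Poly_Mapping.keys p \<Longrightarrow> sum (Poly_Mapping.lookup a) UNIV \<le> rpoly_degree p"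
  unfolding rpoly_degree_def by (rule Max_ge) auto

lemma Im_euler_rpoly_eval:
  assumes "rpoly_degree p \<le> 2"
  shows "Im_euler (rpoly_eval p) 0 z"
proof -
  \<comment> \<open>The defect 0 is spelled out as a sum of multiples of 0 to match the sum and
    scaling rules.\<close>
  have "Im_euler (rpoly_eval p)
      (\<Sum>a\<in>Poly_Mapping.keys p. Poly_Mapping.lookup p a * 0) z"
    unfolding rpoly_eval_def
    by (intro Im_euler_sum Im_euler_cmult Im_euler_monomial
        order_trans[OF sum_lookup_le_rpoly_degree assms])
  then show ?thesis by simp
qed

section \<open>Dilogarithms of exponentials of linear forms\<close>

lemma DERIV_dilog:
  assumes "z \<notin> dilog_cut"
  shows "(dilog has_field_derivative dilog_integrand z) (at z)"
proof -
  obtain F where F: "\<And>t. t \<in> - dilog_cut \<Longrightarrow> (F has_field_derivative dilog_integrand t) (at t)"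
    using holomorphic_starlike_primitive[OF holomorphic_on_imp_continuous_on
        [OF holomorphic_dilog_integrand] starlike_dilog_domain open_dilog_domain, of "{}"]
      holomorphic_dilog_integrand open_dilog_domain
    by (auto simp: holomorphic_on_open field_differentiable_def)
  \<comment> \<open>The segment from 0 to \<open>t\<close> stays in the domain, so integrating along
    it evaluates the primitive \<open>F\<close> at its endpoints.\<close>
  have eq: "dilog t = F t - F 0" if "t \<in> - dilog_cut" for t
    unfolding dilog_def
  proof (rule contour_integral_unique)
    show "(dilog_integrand has_contour_integral F t - F 0) (linepath 0 t)"
      using contour_integral_primitive[of "- dilog_cut" F dilog_integrand "linepath 0 t"]
        has_field_derivative_at_within[OF F] segment_dilog_domain that by simp
  qed
  have "((\<lambda>t. F t - F 0) has_field_derivative dilog_integrand z) (at z)"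
    using DERIV_diff[OF F DERIV_const, of z "F 0"] assms by simp
  then show ?thesis
    by (rule has_field_derivative_transform_within_open[OF _ open_dilog_domain])
      (use assms eq in auto)
qed

lemma DERIV_exp_form_coord_update:
  "((\<lambda>w. exp_form v (coord_update z j w)) has_field_derivative
     \<i> * of_real (v $ j) * exp_form v z) (at (z $ j))"
proof -
  have "((\<lambda>w. \<Sum>i\<in>UNIV. of_real (v $ i) * coord_update z j w $ i) has_field_derivative
      (\<Sum>i\<in>UNIV. of_real (v $ i) * (if i = j then 1 else 0))) (at (z $ j))"
    by (intro DERIV_sum DERIV_cmult DERIV_coord_update)
  then have "((\<lambda>w. \<Sum>i\<in>UNIV. of_real (v $ i) * coord_update z j w $ i) has_field_derivative
      of_real (v $ j)) (at (z $ j))"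
    by (simp add: if_distrib[of "\<lambda>c. _ * c"] cong: if_cong)
  from DERIV_chain2[OF DERIV_exp DERIV_cmult[OF this, of \<i>]] show ?thesis
    by (simp add: exp_form_def mult_ac)
qed

text \<open>Since \<open>v\<close> is real, the exponent has real part minus the form applied to
  \<open>Im z\<close>.\<close>

lemma ln_cmod_exp_form: "ln (cmod (exp_form v z)) = - (\<Sum>j\<in>UNIV. v $ j * Im (z $ j))"
  by (simp add: exp_form_def)

text \<open>The factor \<open>exp_form v z\<close> from the chain rule cancels the denominator of
  \<open>dilog_integrand\<close>. As \<open>Re (- \<i> * c) = Im c\<close>, the gradient sum is
  \<open>- ln (cmod w) * Im (Ln (1 - w))\<close> with \<open>w = exp_form v z\<close>, which cancels
  the logarithmic term of \<open>bloch_wigner\<close>.\<close>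

lemma Im_euler_dilog_exp_form:
  assumes "exp_form v z \<notin> dilog_cut"
  shows "Im_euler (\<lambda>x. dilog (exp_form v x)) (bloch_wigner (exp_form v z)) z"
proof (rule Im_eulerI)
  let ?w = "exp_form v z"
  \<comment> \<open>An exponential is never 0, and 1 lies on the cut, so the special values in
    \<open>bloch_wigner\<close> and \<open>dilog_integrand\<close> do not occur.\<close>
  have w: "?w \<noteq> 0" "?w \<noteq> 1"
    using assms by (auto simp: exp_form_def mem_dilog_cut_iff)
  show "((\<lambda>w. dilog (exp_form v (coord_update z j w))) has_field_derivative
      - \<i> * of_real (v $ j) * Ln (1 - ?w)) (at (z $ j))" for j
    using DERIV_chain2[OF _ DERIV_exp_form_coord_update, of dilog "dilog_integrand ?w" v z j]
      DERIV_dilog[OF assms] w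
    by (simp add: dilog_integrand_def mult_ac)
  show "Im (dilog ?w) = bloch_wigner ?w
      + (\<Sum>j\<in>UNIV. Re (- \<i> * of_real (v $ j) * Ln (1 - ?w)) * Im (z $ j))"
    using w by (simp add: bloch_wigner_def ln_cmod_exp_form sum_distrib_left mult_ac)
qed

lemma open_exp_form_domain:
  fixes l :: "real ^ 'n ^ 'm"
  shows "open {z. \<forall>k. exp_form (l $ k) z \<notin> dilog_cut}"
proof -
  have "{z. \<forall>k. exp_form (l $ k) z \<notin> dilog_cut} = (\<Inter>k. exp_form (l $ k) -` (- dilog_cut))"
    by auto
  moreover have "open (exp_form (l $ k) -` (- dilog_cut))" for k
    unfolding exp_form_def by (intro open_vimage open_dilog_domain continuous_intros)
  ultimately show ?thesis by (auto intro: open_INT)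
qed

theorem lemma2p2:
  fixes r :: "real ^ 'm"
    and l :: "real ^ 'n ^ 'm"
    and p :: "'n rpoly"
    and U :: "(complex ^ 'n) set"
    and f :: "complex ^ 'n \<Rightarrow> complex"
  assumes deg: "rpoly_degree p \<le> 2"
    and U: "U = {z. \<forall>k. exp_form (l $ k) z \<notin> complex_of_real ` {1..}}"
    and f: "\<And>z. z \<in> U \<Longrightarrow>
      f z = (\<Sum>k\<in>UNIV. of_real (r $ k) * dilog (exp_form (l $ k) z)) + rpoly_eval p z"
  shows "(\<forall>z\<in>U. Im (f z) =
            (\<Sum>k\<in>UNIV. r $ k * bloch_wigner (exp_form (l $ k) z))
            + (\<Sum>j\<in>UNIV. Re (complex_gradient f z $ j) * Im (z $ j)))
       \<and> (\<forall>z0\<in>U. complex_gradient f z0 = 0 \<longrightarrow>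
            Im (f z0) = (\<Sum>k\<in>UNIV. r $ k * bloch_wigner (exp_form (l $ k) z0)))"
proof -
  have "Im_euler f (\<Sum>k\<in>UNIV. r $ k * bloch_wigner (exp_form (l $ k) z)) z" if "z \<in> U" for z
  proof (rule Im_euler_transform_open[OF _ _ that f])
    \<comment> \<open>The final \<open>+ 0\<close> is the defect of the polynomial.\<close>
    have "Im_euler (\<lambda>z. (\<Sum>k\<in>UNIV. of_real (r $ k) * dilog (exp_form (l $ k) z)) + rpoly_eval p z)
        ((\<Sum>k\<in>UNIV. r $ k * bloch_wigner (exp_form (l $ k) z)) + 0) z"
      using that unfolding U
      by (intro Im_euler_add Im_euler_sum Im_euler_cmult Im_euler_dilog_exp_form
          Im_euler_rpoly_eval deg) simp
    then show "Im_euler (\<lambda>z. (\<Sum>k\<in>UNIV. of_real (r $ k) * dilog (exp_form (l $ k) z)) + rpoly_eval p z)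
        (\<Sum>k\<in>UNIV. r $ k * bloch_wigner (exp_form (l $ k) z)) z"
      by simp
    show "open U"
      unfolding U by (rule open_exp_form_domain)
  qed
  \<comment> \<open>At a critical point every term of the gradient sum vanishes, which gives the
    second claim.\<close>
  from Im_euler_gradient[OF this] show ?thesis
    by simp
qed

end
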